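(* Let $\alpha=k+\frac12$ with $k\in\mathbb{N}$, and $\lambda\in\mathbb{R}$. Let $S_n(\zeta;\mu)$ be defined by $S_{-1}(\zeta;\mu)=S_0(\zeta;\mu)=1$ and $$S_{n+1}S_{n-1}=-\zeta\left[S_n\frac{d^2S_n}{d\zeta^2}-\left(\frac{dS_n}{d\zeta}\right)^2\right]-S_n\frac{dS_n}{d\zeta}+(\zeta+\mu)S_n^2.$$ Let $$y(x)=\frac{S_k(-x;\lambda+1)S_{k-1}(-x;\lambda)}{S_k(-x;\lambda)S_{k-1}(-x;\lambda+1)},$$ which satisfies the third Painlev\'e equation $P_{III}(2k-2\lambda-1,2k+2\lambda+1,1,-1)$, i.e. $y''=\frac{(y')^2}{y}-\frac{y'}{x}+\frac{ay^2+b}{x}+y^3-\frac1y$ with $a=2k-2\lambda-1$, $b=2k+2\lambda+1$. Let $$R(x)=y'(x)+y^2(x)+\frac{(2k-2\lambda)y(x)}{x}+1,\qquad g(s)=1-\frac{2}{R(\sqrt s)},$$ $$\mathcal{H}(s)=\frac{(sg'(s))^2}{4g(s)(g(s)-1)^2}-\frac{1}{4g(s)}\left[\lambda+\left(k+\tfrac12\right)g(s)\right]^2+\frac{sg(s)}{4(g(s)-1)}.$$ Then $g$ is a rational solution of $$g''=\frac{3g-1}{2g(g-1)}(g')^2-\frac{g'}{s}+\frac{(g-1)^2}{2s^2}\left(\alpha^2g-\frac{\lambda^2}{g}\right)+\frac{g}{2s}$$ (i.e. $P_V(\frac{\alpha^2}{2},-\frac{\lambda^2}{2},\frac12,0)$),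 and $\mathcal{H}$ is the corresponding solution of $$(s\mathcal{H}'')^2=\mathcal{H}'(4\mathcal{H}'-1)(\mathcal{H}-s\mathcal{H}')+\frac1{16}\left[4(\alpha+\lambda)\mathcal{H}'-\lambda\right]^2.$$
   Context: Here $\mathbb{N}=\{0,1,2,\dots\}$ and primes denote derivatives with respect to the indicated variable.
   Formalization: "Rational" is taken as rational in √s (for k=0, λ=1 one gets g=-1/(√s-1), not rational in s); the equations are asserted for s>0 outside a finite set; for λ=0, where g≡0 and H is undefined, they hold only under the convention 1/0=0. *)

theory Defs
  imports "HOL-Analysis.Analysis" "HOL-Computational_Algebra.Polynomial"
begin

text \<open>Shifted sequence: Sshift mu n is the polynomial S_{n-1}(zeta; mu) in zeta.
  S_{-1} = S_0 = 1 and
  S_{n+1} S_{n-1} = -zeta (S_n S_n'' - (S_n')^2) - S_n S_n' + (zeta + mu) S_n^2,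
  i.e. S_{n+1} is the (exact) polynomial quotient of the right-hand side by S_{n-1}.\<close>
fun Sshift :: "real \<Rightarrow> nat \<Rightarrow> real poly" where
  "Sshift mu 0 = 1"
| "Sshift mu (Suc 0) = 1"
| "Sshift mu (Suc (Suc n)) =
     (- [:0, 1:] * (Sshift mu (Suc n) * pderiv (pderiv (Sshift mu (Suc n)))
                     - (pderiv (Sshift mu (Suc n)))^2)
      - Sshift mu (Suc n) * pderiv (Sshift mu (Suc n))
      + [:mu, 1:] * (Sshift mu (Suc n))^2) div Sshift mu n"

definition S :: "real \<Rightarrow> int \<Rightarrow> real poly" where
  "S mu n = Sshift mu (nat (n + 1))"

end

theory Submission
  imports Defs "HOL-Computational_Algebra.Formal_Laurent_Series"
    "HOL-Computational_Algebra.Polynomial_FPS" "HOL-Computational_Algebra.Polynomial_Factorial"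
    "HOL-Computational_Algebra.Field_as_Ring"
begin

text \<open>
  Write \<open>P\<^sub>n\<close> for \<open>S\<^sub>n(\<zeta>; \<mu>)\<close>, \<open>T\<^sub>n\<close> for \<open>S\<^sub>n(\<zeta>; \<mu> + 1)\<close>, \<open>L\<close> for the logarithmic derivative in \<open>\<zeta>\<close>,
  and \<open>Q\<^sub>n = P\<^sub>n\<^sub>+\<^sub>1 P\<^sub>n\<^sub>-\<^sub>1 / P\<^sub>n\<^sup>2\<close>. The recursion says \<open>Q\<^sub>n = \<zeta> + \<mu> - (\<zeta> L P\<^sub>n)'\<close>. In the field of
  Laurent series one proves by induction the Wronskian relation
  \<open>(L P\<^sub>n\<^sub>+\<^sub>1 - L P\<^sub>n\<^sub>-\<^sub>1) Q\<^sub>n = 2 n + 1\<close> and, for \<open>y\<^sub>n = T\<^sub>n P\<^sub>n\<^sub>-\<^sub>1 / (P\<^sub>n T\<^sub>n\<^sub>-\<^sub>1)\<close>, the relations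
  \<open>L P\<^sub>n - L T\<^sub>n\<^sub>-\<^sub>1 = y\<^sub>n - 1\<close>, \<open>L T\<^sub>n - L P\<^sub>n\<^sub>-\<^sub>1 = 1 - 1 / y\<^sub>n\<close> and
  \<open>\<zeta> (L T\<^sub>n - L P\<^sub>n) = \<zeta> - n + \<mu> - Q\<^sub>n / y\<^sub>n\<close>.

  The division defining \<open>S\<^sub>n\<^sub>+\<^sub>1\<close> is exact: \<open>P\<^sub>n\<^sub>-\<^sub>1\<close> always divides the numerator times \<open>P\<^sub>n\<^sub>-\<^sub>2\<^sup>2\<close>, the
  Wronskian relation excludes common factors of consecutive \<open>P\<^sub>n\<close> other than powers of \<open>\<zeta>\<close>, and
  the vanishing order at \<open>\<zeta> = 0\<close> does not decrease with \<open>n\<close>.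

  With \<open>x = - \<zeta>\<close> the relations become a first-order system for \<open>y\<close> and \<open>Q = Q\<^sub>k\<close> (equivalent to
  \<open>P\<^sub>I\<^sub>I\<^sub>I\<close>) in which \<open>R = - 2 Q / x\<close>. So \<open>g = 1 + x / Q\<close>, and in the variables \<open>g\<close>, \<open>p = Q / y\<close> the
  system implies \<open>P\<^sub>V\<close> and \<open>H' = g / (4 (g - 1))\<close>, from which the last equation is an algebraic
  identity.
\<close>

section \<open>The Toda equation in a differential field\<close>

text \<open>A derivation makes logarithmic derivatives available, and \<open>Z\<close> plays the
  role of zeta. The instance used below is the field of real Laurent series in zeta.\<close>

locale differential_field =
  fixes D :: "'a::field_char_0 \<Rightarrow> 'a" and Z :: 'a
  assumes D_add: "D (a + b) = D a + D b"
    and D_mult: "D (a * b) = D a * b + a * D b"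
    and D_Z: "D Z = 1"
begin

lemma D_0: "D 0 = 0"
  using D_add[of 0 0] by simp

lemma D_1: "D 1 = 0"
  using D_mult[of 1 1] by simp

lemma D_minus: "D (- a) = - D a"
  using D_add[of a "- a"] D_0 by (simp add: eq_neg_iff_add_eq_0 add.commute)

lemma D_diff: "D (a - b) = D a - D b"
  using D_add[of a "- b"] D_minus by simp

lemma D_of_nat: "D (of_nat n) = 0"
  by (induction n) (simp_all add: D_0 D_1 D_add)

lemma D_numeral: "D (numeral n) = 0"
  using D_of_nat[of "numeral n"] by simp

lemma D_power2: "D (a\<^sup>2) = 2 * a * D a"
  by (simp add: power2_eq_square D_mult)

lemma D_divide:
  assumes "b \<noteq> 0"
  shows "D (a / b) = (D a * b - a * D b) / b\<^sup>2"
proof -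
  have "D a = D (a / b) * b + (a / b) * D b"
    using D_mult[of "a / b" b] assms by simp
  then show ?thesis
    using assms by (simp add: field_simps power2_eq_square)
qed

lemmas D_simps = D_0 D_1 D_minus D_diff D_add D_of_nat D_numeral D_power2 D_mult D_Z

definition L :: "'a \<Rightarrow> 'a" where "L a = D a / a"

lemma D_eq_L: "a \<noteq> 0 \<Longrightarrow> D a = a * L a"
  by (simp add: L_def)

lemma L_1: "L 1 = 0"
  by (simp add: L_def D_1)

lemma L_mult: "a \<noteq> 0 \<Longrightarrow> b \<noteq> 0 \<Longrightarrow> L (a * b) = L a + L b"
  by (simp add: L_def D_mult field_simps)

lemma L_divide: "a \<noteq> 0 \<Longrightarrow> b \<noteq> 0 \<Longrightarrow> L (a / b) = L a - L b"
  using L_mult[of "a / b" b] by simp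

lemma L_power2: "a \<noteq> 0 \<Longrightarrow> L (a\<^sup>2) = 2 * L a"
  by (simp add: power2_eq_square L_mult)

section \<open>The Toda recursion and its Wronskian relation\<close>

definition toda :: "'a \<Rightarrow> 'a \<Rightarrow> 'a" where
  "toda m f = - Z * (f * D (D f) - (D f)\<^sup>2) - f * D f + (Z + m) * f\<^sup>2"

text \<open>Division by \<open>f\<^sup>2\<close> leaves an expression affine in \<open>L f\<close>,
  so differences of the ratios \<open>Q\<close> below become derivatives of differences of
  \<open>L\<close>.\<close>

lemma toda_eq_L:
  assumes "f \<noteq> 0"
  shows "toda m f = f\<^sup>2 * (Z + m - D (Z * L f))"
proof -
  have "D (L f) * f\<^sup>2 = D (D f) * f - (D f)\<^sup>2"
    using assms by (simp add: L_def D_divide power2_eq_square)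
  moreover have "L f * f\<^sup>2 = f * D f"
    using assms by (simp add: L_def power2_eq_square)
  ultimately show ?thesis
    unfolding toda_def D_mult D_Z by algebra
qed

text \<open>Indexed as \<open>Sshift\<close>: \<open>tau m n\<close> stands for S_(n-1) at the
  parameter \<open>m\<close>. The division is that of the field, so the relations below rest on
  nonvanishing of the terms.\<close>

fun tau :: "'a \<Rightarrow> nat \<Rightarrow> 'a" where
  "tau m 0 = 1"
| "tau m (Suc 0) = 1"
| "tau m (Suc (Suc n)) = toda m (tau m (Suc n)) / tau m n"

text \<open>In terms of S this is S_(n+1) S_(n-1) / S_n^2, the index of \<open>tau\<close> being
  shifted by one.\<close>

definition Q :: "'a \<Rightarrow> nat \<Rightarrow> 'a" where
  "Q m n = tau m (Suc (Suc n)) * tau m n / (tau m (Suc n))\<^sup>2"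

lemma Q_eq_L:
  assumes "tau m n \<noteq> 0" "tau m (Suc n) \<noteq> 0"
  shows "Q m n = Z + m - D (Z * L (tau m (Suc n)))"
  using assms by (simp add: Q_def toda_eq_L)

lemma D_Q:
  assumes "tau m n \<noteq> 0" "tau m (Suc n) \<noteq> 0" "tau m (Suc (Suc n)) \<noteq> 0"
  shows "D (Q m n) = Q m n * (L (tau m (Suc (Suc n))) + L (tau m n) - 2 * L (tau m (Suc n)))"
proof -
  have "Q m n \<noteq> 0"
    using assms by (simp add: Q_def del: tau.simps)
  moreover have "L (Q m n) = L (tau m (Suc (Suc n))) + L (tau m n) - 2 * L (tau m (Suc n))"
    using assms by (simp add: Q_def L_divide L_mult L_power2 del: tau.simps)
  ultimately show ?thesis
    using D_eq_L by simp
qed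

text \<open>Here \<open>q\<close> is a ratio \<open>Q\<close>, and \<open>v\<close>,
  \<open>w\<close> are the increments of \<open>L\<close> after and before its middle term;
  \<open>q - D (Z * v)\<close> and \<open>q + D (Z * w)\<close> are then the next and the previous
  ratio. Differentiating \<open>(v + w) * q = c\<close> gives D (v + w) = w^2 - v^2, and one more
  derivative supplies the second-order terms that carry one Riccati relation to the other.\<close>

lemma riccati_step:
  assumes Q: "q \<noteq> 0" "D q = q * (v - w)" "(v + w) * q = c" "D c = 0"
    and w: "D (q + D (Z * w)) - 2 * w * (q + D (Z * w)) = 2 - c"
  shows "D (q - D (Z * v)) + 2 * v * (q - D (Z * v)) = c + 2"
proof -
  have "D (v + w) * q + (v + w) * D q = 0"
    using arg_cong[OF Q(3), of D] Q(4) by (simp add: D_mult)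
  then have "q * (D (v + w) + (v + w) * (v - w)) = 0"
    using Q(2) by algebra
  then have "D (v + w) + (v + w) * (v - w) = 0"
    using Q(1) by simp
  then have p: "D (v + w) = w\<^sup>2 - v\<^sup>2"
    by algebra
  then have "D (D (v + w)) = D (w\<^sup>2 - v\<^sup>2)"
    by simp
  then have p': "D (D v) + D (D w) = 2 * w * D w - 2 * v * D v"
    by (simp add: D_simps)
  show ?thesis
    using w Q(2,3) p p' unfolding D_simps by algebra
qed

text \<open>The step uses the relations of two consecutive ratios, so the induction carries both,
  together with the nonvanishing under which \<open>L\<close> and \<open>Q\<close> are
  meaningful.\<close>

lemma Q_riccati_aux:
  assumes m: "D m = 0"
  shows "tau m n \<noteq> 0 \<and> tau m (Suc n) \<noteq> 0 \<and> tau m (Suc (Suc n)) \<noteq> 0 \<and>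
    D (Q m n) + 2 * (L (tau m (Suc n)) - L (tau m n)) * Q m n = of_nat (2 * n + 1) \<and>
    D (Q m (Suc n)) + 2 * (L (tau m (Suc (Suc n))) - L (tau m (Suc n))) * Q m (Suc n)
      = of_nat (2 * n + 3)"
proof (induction n)
  case 0
  define M where "M = Z + m"
  have DM: "D M = 1"
    by (simp add: M_def D_simps m)
  then have M0: "M \<noteq> 0"
    using D_0 by auto
  have t2: "tau m (Suc (Suc 0)) = M"
    by (simp add: toda_def D_simps M_def)
  have Q0: "Q m 0 = M"
    unfolding Q_def t2 by simp
  have LM: "L M = 1 / M"
    by (simp add: L_def DM)
  have Q1: "Q m (Suc 0) = M - 1 / M + Z / M\<^sup>2"
    using M0 by (subst Q_eq_L)
      (simp_all add: t2 LM D_simps D_divide DM flip: M_def del: tau.simps(3),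
       simp add: field_simps power2_eq_square)
  have "D (Q m (Suc 0)) + 2 * L M * Q m (Suc 0) = 3"
    unfolding Q1 LM using M0
    by (simp add: D_simps D_divide DM) (simp add: field_simps power2_eq_square power4_eq_xxxx)
  then show ?case
    using M0 DM by (simp add: t2 Q0 L_1 del: tau.simps(3))
next
  case (Suc n)
  let ?t = "tau m"
  have nz: "?t n \<noteq> 0" "?t (Suc n) \<noteq> 0" "?t (Suc (Suc n)) \<noteq> 0"
    using Suc by auto
  have R1: "D (Q m n) + 2 * (L (?t (Suc n)) - L (?t n)) * Q m n = of_nat (2 * n + 1)"
    and R2: "D (Q m (Suc n)) + 2 * (L (?t (Suc (Suc n))) - L (?t (Suc n))) * Q m (Suc n)
      = of_nat (2 * n + 3)"
    using Suc by blast+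
  \<comment> \<open>A vanishing ratio would turn the Riccati relation into 0 = 2 n + 3, impossible
    in characteristic zero; this gives the nonvanishing of the next term.\<close>
  have "Q m (Suc n) \<noteq> 0"
  proof
    assume "Q m (Suc n) = 0"
    with R2 have "of_nat (2 * n + 3) = (0 :: 'a)"
      by (simp add: D_0 del: of_nat_add of_nat_mult)
    then show False
      by (simp only: of_nat_eq_0_iff)
  qed
  then have nz3: "?t (Suc (Suc (Suc n))) \<noteq> 0"
    by (auto simp: Q_def simp del: tau.simps)
  define v where "v = L (?t (Suc (Suc (Suc n)))) - L (?t (Suc (Suc n)))"
  define w where "w = L (?t (Suc (Suc n))) - L (?t (Suc n))"
  note Q_eqs = Q_eq_L[OF nz(1,2)] Q_eq_L[OF nz(2,3)] Q_eq_L[OF nz(3) nz3]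
  have Q1: "Q m n = Q m (Suc n) + D (Z * w)"
    unfolding Q_eqs w_def by (simp add: D_diff algebra_simps)
  have Q3: "Q m (Suc (Suc n)) = Q m (Suc n) - D (Z * v)"
    unfolding Q_eqs v_def by (simp add: D_diff algebra_simps)
  have DQ: "D (Q m (Suc n)) = Q m (Suc n) * (v - w)"
    unfolding v_def w_def by (subst D_Q[OF nz(2,3) nz3]) (simp add: algebra_simps)
  \<comment> \<open>Substituting \<open>DQ\<close> turns the Riccati relation into the Wronskian
    relation.\<close>
  have pQ: "(v + w) * Q m (Suc n) = of_nat (2 * n + 3)"
    using R2 unfolding w_def[symmetric] DQ by (simp add: algebra_simps)
  \<comment> \<open>Eliminating the increment that precedes \<open>w\<close> rewrites the relation
    for \<open>Q m n\<close> in terms of \<open>w\<close>, with reversed sign, as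
    \<open>riccati_step\<close> expects.\<close>
  have "D (Q m n) = Q m n * (w - (L (?t (Suc n)) - L (?t n)))"
    unfolding w_def by (subst D_Q[OF nz]) (simp add: algebra_simps)
  moreover have "D (Q m n) + 2 * (L (?t (Suc n)) - L (?t n)) * Q m n = of_nat (2 * n + 3) - 2"
    using R1 by simp
  moreover define c :: 'a where "c = of_nat (2 * n + 3)"
  ultimately have "D (Q m n) - 2 * w * Q m n = 2 - of_nat (2 * n + 3)"
    unfolding c_def[symmetric] by algebra
  then have "D (Q m (Suc (Suc n))) + 2 * v * Q m (Suc (Suc n)) = of_nat (2 * n + 3) + 2"
    unfolding Q3 Q1 using \<open>Q m (Suc n) \<noteq> 0\<close> DQ pQ by (intro riccati_step D_of_nat)
  then have "D (Q m (Suc (Suc n))) + 2 * v * Q m (Suc (Suc n)) = of_nat (2 * Suc n + 3)"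
    by simp
  moreover have "of_nat (2 * n + 3) = (of_nat (2 * Suc n + 1) :: 'a)"
    by (intro arg_cong[of _ _ of_nat]) simp
  ultimately show ?case
    using nz nz3 R2 unfolding v_def by metis
qed

lemma tau_nonzero: "D m = 0 \<Longrightarrow> tau m n \<noteq> 0"
  using Q_riccati_aux[of m n] by blast

lemma Q_riccati:
  "D m = 0 \<Longrightarrow> D (Q m n) + 2 * (L (tau m (Suc n)) - L (tau m n)) * Q m n = of_nat (2 * n + 1)"
  using Q_riccati_aux[of m n] by blast

lemma Q_nonzero: "D m = 0 \<Longrightarrow> Q m n \<noteq> 0"
  by (simp add: Q_def tau_nonzero del: tau.simps)

text \<open>This is the Wronskian relation: inserting \<open>D_Q\<close> into
  \<open>Q_riccati\<close> cancels the middle logarithmic derivative.\<close>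

lemma L_gap:
  assumes "D m = 0"
  shows "L (tau m (Suc (Suc n))) = L (tau m n) + of_nat (2 * n + 1) / Q m n"
proof -
  have "(L (tau m (Suc (Suc n))) - L (tau m n)) * Q m n = of_nat (2 * n + 1)"
    using Q_riccati[OF assms, of n] D_Q[of m n] tau_nonzero[OF assms]
    by (simp add: algebra_simps del: tau.simps)
  then show ?thesis
    using Q_nonzero[OF assms, of n] by (simp add: field_simps del: tau.simps)
qed

section \<open>Relations between the parameters \<open>m\<close> and \<open>m + 1\<close>\<close>

definition Y :: "'a \<Rightarrow> nat \<Rightarrow> 'a" where
  "Y m n = tau (m + 1) (Suc n) * tau m n / (tau m (Suc n) * tau (m + 1) n)"

lemma Y_nonzero: "D m = 0 \<Longrightarrow> Y m n \<noteq> 0"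
  by (simp add: Y_def tau_nonzero D_add D_1)

text \<open>The three relations feed each other, hence a single induction. \<open>L_gap\<close> at
  both parameters advances the indices of \<open>L\<close>, and comparing \<open>Q\<close> at
  \<open>m + 1\<close> with \<open>Q\<close> at \<open>m\<close> advances \<open>Y\<close>.\<close>

lemma Y_relations:
  assumes m: "D m = 0"
  shows "L (tau m (Suc n)) - L (tau (m + 1) n) = Y m n - 1 \<and>
    L (tau (m + 1) (Suc n)) - L (tau m n) = 1 - 1 / Y m n \<and>
    Z * (L (tau (m + 1) (Suc n)) - L (tau m (Suc n))) = Z - (of_nat n - m) - Q m n / Y m n"
proof (induction n)
  case 0
  have "Q m 0 = Z + m"
    by (simp add: Q_def toda_def D_simps)
  moreover have "Y m 0 = 1"
    by (simp add: Y_def)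
  ultimately show ?case
    by (simp add: L_1)
next
  case (Suc n)
  define m' where "m' = m + 1"
  have m': "D m' = 0"
    by (simp add: m'_def D_simps m)
  \<comment> \<open>Neither prime is a derivative: \<open>q'\<close> belongs to the parameter
    \<open>m + 1\<close>, while \<open>y'\<close> is the next ratio at the same
    \<open>m\<close>.\<close>
  define y q q' y' where "y = Y m n" and "q = Q m n" and "q' = Q m' n" and "y' = Y m (Suc n)"
  define c :: 'a where "c = of_nat (2 * n + 1)"
  define p0 p1 p2 where "p0 = L (tau m n)" and "p1 = L (tau m (Suc n))"
    and "p2 = L (tau m (Suc (Suc n)))"
  define h0 h1 h2 where "h0 = L (tau m' n)" and "h1 = L (tau m' (Suc n))"
    and "h2 = L (tau m' (Suc (Suc n)))"
  note defs = y_def q_def q'_def y'_def c_def p0_def p1_def p2_def h0_def h1_def h2_def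
  have IH: "p1 - h0 = y - 1" "h1 - p0 = 1 - 1 / y"
      "Z * (h1 - p1) = Z - (of_nat n - m) - q / y"
    using Suc unfolding defs m'_def by auto
  have nz: "y \<noteq> 0" "q \<noteq> 0" "q' \<noteq> 0" "y' \<noteq> 0"
    unfolding defs using Y_nonzero Q_nonzero m m' by auto
  have gaps: "p2 = p0 + c / q" "h2 = h0 + c / q'"
    unfolding defs by (rule L_gap[OF m] L_gap[OF m'])+
  have LY: "L (Y m j) = L (tau m' (Suc j)) + L (tau m j) - L (tau m (Suc j)) - L (tau m' j)" for j
    unfolding Y_def m'_def[symmetric]
    by (subst L_divide L_mult; simp add: tau_nonzero m m' L_mult del: tau.simps)+
  have Dy: "D y = y * (h1 + p0 - p1 - h0)"
    using D_eq_L[OF nz(1)] LY[of n] unfolding defs by simp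
  have Dy': "D y' = y' * (h2 + p1 - p2 - h1)"
    using D_eq_L[OF nz(4)] LY[of "Suc n"] unfolding defs by simp
  have Dq: "D q = c - 2 * (p1 - p0) * q"
    using Q_riccati[OF m, of n] unfolding defs by (simp add: algebra_simps)
  have q'_eq: "q' = q + 1 - D (Z * (h1 - p1))"
    unfolding defs using m m' tau_nonzero
    by (simp add: Q_eq_L m'_def[symmetric] D_diff right_diff_distrib)
  \<comment> \<open>The third relation is differentiated; \<open>Z\<close> contributes the 1 that
    offsets the parameter shift.\<close>
  have q'_D: "q' = q + D (q / y)"
    unfolding q'_eq IH(3) by (simp add: D_simps m)
  \<comment> \<open>Expanding D (q / y) by the Riccati relation for \<open>q\<close> and the
    logarithmic derivative of \<open>y\<close> removes all derivatives and leaves an algebraic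
    relation.\<close>
  have key: "q' * y\<^sup>2 = q + c * y"
  proof -
    have 1: "D (q / y) * y\<^sup>2 = D q * y - q * D y"
      using nz by (simp add: D_divide)
    have 2: "(h1 - p0) * y = y - 1"
      unfolding IH(2) using nz by (simp add: field_simps)
    show ?thesis
      unfolding q'_D using 1 2 IH(1) Dy Dq by algebra
  qed
  have y'_eq: "y' = y * q' / q"
    unfolding y'_def y_def q'_def q_def Y_def Q_def m'_def[symmetric]
    using tau_nonzero[OF m] tau_nonzero[OF m']
    by (simp add: field_simps power2_eq_square del: tau.simps)
  have y'_sum: "y' = 1 / y + c / q"
    unfolding y'_eq using key nz by (simp add: field_simps power2_eq_square)
  have B2: "p2 - h1 = y' - 1"
    using gaps(1) IH(2) y'_sum by (simp add: algebra_simps)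
  have B3: "h2 - p1 = 1 - 1 / y'"
  proof -
    have "c / q' - y = - 1 / y'"
      unfolding y'_eq using key nz by (simp add: field_simps power2_eq_square)
    then show ?thesis
      using gaps(2) IH(1) by (simp add: algebra_simps)
  qed
  \<comment> \<open>The third relation at the new index involves the next ratio \<open>q2\<close>.
    It is computed from \<open>Z * (p2 - p1)\<close>, which the first relation at the new index and
    the third at the old one determine.\<close>
  define q2 where "q2 = Q m (Suc n)"
  have "Z * (p2 - p1) = Z * y' - (of_nat n - m) - q / y"
    using B2 IH(3) by algebra
  then have "D (Z * (p2 - p1)) = y' + Z * D y' - D (q / y)"
    by (simp add: D_simps m)
  moreover have "q2 = q - D (Z * (p2 - p1))"
    unfolding q2_def q_def p2_def p1_def using m tau_nonzero
    by (simp add: Q_eq_L D_diff right_diff_distrib del: tau.simps(3))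
  ultimately have q2: "q2 = q' - y' - Z * D y'"
    using q'_D by simp
  have "(q / y) * y' = q'"
    using nz by (simp add: y'_eq)
  then have "Z * (h1 - p1) * y' = (Z - (of_nat n - m)) * y' - q'"
    unfolding IH(3) left_diff_distrib by simp
  then have "Z * (h2 - p2) * y' = (Z - (of_nat (Suc n) - m)) * y' - q2"
    unfolding q2 Dy' of_nat_Suc by (simp add: algebra_simps)
  then have "Z * (h2 - p2) = Z - (of_nat (Suc n) - m) - q2 / y'"
    using nz by (simp add: field_simps)
  with B2 B3 show ?case
    unfolding defs q2_def m'_def by blast
qed

end

section \<open>Exactness of the polynomial division\<close>

definition poly_toda :: "real \<Rightarrow> real poly \<Rightarrow> real poly" where
  "poly_toda mu f = - [:0, 1:] * (f * pderiv (pderiv f) - (pderiv f)\<^sup>2)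
     - f * pderiv f + [:mu, 1:] * f\<^sup>2"

lemma not_dvd_pderiv_prime:
  fixes p :: "real poly"
  assumes "prime_elem p"
  shows "\<not> p dvd pderiv p"
proof
  assume *: "p dvd pderiv p"
  have "degree p \<noteq> 0"
    using assms is_unit_iff_degree[of p] by (auto simp: prime_elem_def)
  then have "pderiv p \<noteq> 0" "degree (pderiv p) < degree p"
    by (simp_all add: pderiv_eq_0_iff degree_pderiv)
  with * show False
    using dvd_imp_degree_le[of p "pderiv p"] by simp
qed

lemma pderiv_prime_power_mult:
  fixes p f :: "real poly"
  shows "pderiv (p ^ Suc j * f) = p ^ j * (of_nat (Suc j) * pderiv p * f + p * pderiv f)"
  by (simp add: pderiv_mult pderiv_power_Suc of_nat_poly algebra_simps del: of_nat_Suc power_Suc)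
     (simp add: mult_ac)

lemma prime_not_dvd_of_nat_Suc:
  fixes p :: "real poly"
  assumes "prime_elem p"
  shows "\<not> p dvd of_nat (Suc j)"
proof -
  have "is_unit (of_nat (Suc j) :: real poly)"
    by (simp add: of_nat_poly is_unit_pCons_iff del: of_nat_Suc)
  then show ?thesis
    using assms by (meson dvd_trans prime_elem_not_unit)
qed

text \<open>Modulo \<open>p\<close> the cofactor \<open>M\<close> is zeta (j + 1) p'^2 d^2, where p'
  is the derivative of \<open>p\<close>. None of its factors is divisible by \<open>p\<close>, so
  multiplicity j + 1 in the argument gives exactly 2 j in the value.\<close>

lemma poly_toda_prime_power:
  fixes p :: "real poly"
  assumes p: "prime_elem p" "\<not> p dvd [:0, 1:]" and D: "\<not> p dvd d"
  obtains M where "poly_toda mu (p ^ Suc j * d) = p ^ (2 * j) * M" "\<not> p dvd M"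
proof -
  define G where "G = of_nat (Suc j) * pderiv p * d + p * pderiv d"
  define f where "f = p ^ Suc j * d"
  have f1: "pderiv f = p ^ j * G"
    unfolding f_def G_def by (rule pderiv_prime_power_mult)
  \<comment> \<open>The extra factor \<open>p\<close> avoids the exponent j - 1, which is
    meaningless for j = 0.\<close>
  have pf2: "p * pderiv (pderiv f) = p ^ j * (of_nat j * pderiv p * G + p * pderiv G)"
  proof (cases j)
    case 0
    then show ?thesis using f1 by simp
  next
    case (Suc i)
    then have "pderiv (pderiv f) = p ^ i * (of_nat j * pderiv p * G + p * pderiv G)"
      unfolding f1 by (simp only: pderiv_prime_power_mult)
    then show ?thesis using Suc by (simp add: mult.assoc)
  qed
  define M where "M = - [:0, 1:] * (d * (of_nat j * pderiv p * G + p * pderiv G) - G\<^sup>2)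
    - p * d * G + [:mu, 1:] * p\<^sup>2 * d\<^sup>2"
  have "f * pderiv (pderiv f) = p ^ (2 * j) * (d * (of_nat j * pderiv p * G + p * pderiv G))"
  proof -
    have "f * pderiv (pderiv f) = p ^ j * d * (p * pderiv (pderiv f))"
      by (simp add: f_def mult_ac)
    then show ?thesis
      unfolding pf2 power_even_eq by (simp add: power2_eq_square mult_ac)
  qed
  moreover define P where "P = p ^ j"
  moreover have "f = P * p * d"
    by (simp add: f_def P_def mult_ac)
  ultimately have "poly_toda mu f = P\<^sup>2 * M"
    using f1 unfolding poly_toda_def M_def power_even_eq P_def[symmetric] by algebra
  then have "poly_toda mu f = p ^ (2 * j) * M"
    unfolding P_def power_even_eq .
  moreover have "\<not> p dvd M"
  proof
    assume "p dvd M"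
    \<comment> \<open>\<open>r\<close> collects the terms of \<open>M\<close> that contain
      \<open>p\<close>, divided by \<open>p\<close>.\<close>
    define r where "r = - [:0, 1:] * (d * (of_nat j * pderiv p * pderiv d + pderiv G)
        - 2 * of_nat (Suc j) * pderiv p * d * pderiv d - p * (pderiv d)\<^sup>2)
      - d * G + [:mu, 1:] * p * d\<^sup>2"
    have "M = [:0, 1:] * of_nat (Suc j) * (pderiv p)\<^sup>2 * d\<^sup>2 + p * r"
      unfolding M_def r_def G_def of_nat_Suc by algebra
    with \<open>p dvd M\<close> have "p dvd [:0, 1:] * of_nat (Suc j) * (pderiv p)\<^sup>2 * d\<^sup>2"
      by (simp add: dvd_add_left_iff)
    then show False
      using p D not_dvd_pderiv_prime[OF p(1)] prime_not_dvd_of_nat_Suc[OF p(1)]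
      by (metis prime_elem_dvd_mult_iff prime_elem_dvd_power)
  qed
  ultimately show ?thesis
    using that unfolding f_def by blast
qed

text \<open>At a prime factor \<open>p\<close> of \<open>A\<close> of multiplicity \<open>j + 1\<close>, the Toda equation forces \<open>C\<close> to have
  multiplicity at most \<open>2 j\<close>, while the Wronskian relation forces a positive multiplicity to be at
  least \<open>2 j + 3\<close>.\<close>

lemma toda_no_common_prime:
  fixes p :: "real poly"
  assumes p: "prime_elem p" "\<not> p dvd [:0, 1:]"
    and nz: "A \<noteq> 0" "C \<noteq> 0"
    and T: "C * B = poly_toda mu A"
    and W: "pderiv C * B - C * pderiv B = e * A\<^sup>2"
    and AB: "\<not> (p dvd A \<and> p dvd B)"
  shows "\<not> (p dvd A \<and> p dvd C)"
proof
  assume AC: "p dvd A \<and> p dvd C"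
  then have B: "\<not> p dvd B"
    using AB by blast
  have unit: "\<not> is_unit p" and p0: "p \<noteq> 0"
    using p by (auto simp: prime_elem_def)
  obtain a d where a: "A = p ^ a * d" "\<not> p dvd d"
    using multiplicity_decompose'[OF nz(1) unit] by metis
  obtain c f where c: "C = p ^ c * f" "\<not> p dvd f"
    using multiplicity_decompose'[OF nz(2) unit] by metis
  obtain j i where ji: "a = Suc j" "c = Suc i"
    using a c AC by (metis mult_1 power_0 not0_implies_Suc)
  obtain M where M: "poly_toda mu A = p ^ (2 * j) * M" "\<not> p dvd M"
    using poly_toda_prime_power[OF p a(2), of mu j] a(1) ji by metis
  have "i < 2 * j"
  proof (rule ccontr)
    assume "\<not> i < 2 * j"
    then have "c = 2 * j + Suc (i - 2 * j)"
      using ji by simp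
    then have "p ^ (2 * j) * (p * (p ^ (i - 2 * j) * f * B)) = p ^ (2 * j) * M"
      using T M c by (simp add: power_add mult_ac)
    then have "M = p * (p ^ (i - 2 * j) * f * B)"
      using p0 by simp
    with M(2) show False
      by simp
  qed
  then obtain l where l: "2 * a = i + Suc l"
    using ji less_imp_Suc_add[of i "2 * a"] by auto
  \<comment> \<open>Since \<open>p ^ Suc i\<close> divides \<open>A\<^sup>2\<close>, cancelling
    \<open>p ^ i\<close> in the Wronskian relation and reducing modulo \<open>p\<close> leaves only
    (i + 1) p' f B, which \<open>p\<close> cannot divide.\<close>
  have "p ^ i * ((of_nat (Suc i) * pderiv p * f + p * pderiv f) * B - p * f * pderiv B)
      = p ^ i * (p * (p ^ l * e * d\<^sup>2))"
  proof -
    have "A\<^sup>2 = p ^ i * p * p ^ l * d\<^sup>2"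
      unfolding a power_mult_distrib power_mult[symmetric]
      using l by (simp add: mult.commute power_add)
    then have "p ^ i * (p * (p ^ l * e * d\<^sup>2)) = e * A\<^sup>2"
      by (simp add: mult_ac)
    also have "\<dots> = p ^ i * (of_nat (Suc i) * pderiv p * f + p * pderiv f) * B
        - p ^ Suc i * f * pderiv B"
      using W unfolding c(1) ji(2) pderiv_prime_power_mult by simp
    also have "\<dots> = p ^ i * ((of_nat (Suc i) * pderiv p * f + p * pderiv f) * B
        - p * f * pderiv B)"
      by (simp add: algebra_simps)
    finally show ?thesis ..
  qed
  then have "(of_nat (Suc i) * pderiv p * f + p * pderiv f) * B - p * f * pderiv B
      = p * (p ^ l * e * d\<^sup>2)"
    using p0 by simp
  then have "of_nat (Suc i) * pderiv p * f * B
      = p * (p ^ l * e * d\<^sup>2 - pderiv f * B + f * pderiv B)"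
    by (simp add: algebra_simps)
  then have "p dvd of_nat (Suc i) * pderiv p * f * B"
    by (metis dvd_triv_left)
  then show False
    using B c(2) p(1) not_dvd_pderiv_prime[OF p(1)] prime_not_dvd_of_nat_Suc[OF p(1)]
    by (metis prime_elem_dvd_mult_iff)
qed

text \<open>Zero behaves unlike the other roots: zeta f' / f is regular there, hence so is zeta + mu
  - (zeta f' / f)', the quotient of the Toda expression by f^2.\<close>

lemma order_0_poly_toda:
  assumes "f \<noteq> 0" "poly_toda mu f \<noteq> 0"
  shows "2 * order 0 f \<le> order 0 (poly_toda mu f)"
proof -
  define X :: "real poly" where "X = [:0, 1:]"
  define m where "m = order 0 f"
  obtain d where d: "f = X ^ m * d"
    using order_decomp[OF assms(1), of 0] unfolding X_def m_def by auto
  have X': "pderiv X = 1"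
    by (simp add: X_def pderiv_pCons)
  define G where "G = of_nat m * d + X * pderiv d"
  have XX: "X * pderiv (X ^ m) = of_nat m * X ^ m"
    by (cases m) (simp_all add: pderiv_power_Suc X' of_nat_poly del: of_nat_Suc power_Suc,
      simp add: mult_ac)
  define P where "P = X ^ m"
  have P: "f = P * d" "X * pderiv P = of_nat m * P"
    using d XX by (simp_all add: P_def)
  have Xf: "X * pderiv f = P * G"
    unfolding P(1) G_def pderiv_mult using P(2) by algebra
  have "poly_toda mu f = pderiv f * (X * pderiv f) - f * pderiv (X * pderiv f) + [:mu, 1:] * f\<^sup>2"
    unfolding poly_toda_def X_def[symmetric] pderiv_mult X' by algebra
  also have "\<dots> = P\<^sup>2 * (pderiv d * G - d * pderiv G + [:mu, 1:] * d\<^sup>2)"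
    unfolding Xf unfolding P(1) pderiv_mult by algebra
  finally have "X ^ (2 * m) dvd poly_toda mu f"
    unfolding power_even_eq P_def by simp
  then have "[:- 0, 1:] ^ (2 * m) dvd poly_toda mu f"
    by (simp add: X_def)
  then show ?thesis
    using assms(2) unfolding order_divides m_def by blast
qed

text \<open>The Toda expression of a product splits because logarithmic derivatives add; the term
  zeta + mu is then counted twice, which the summand \<open>M * F\<^sup>2\<close> corrects. It
  remains to see that the corrected expression for \<open>F\<close> vanishes modulo
  \<open>A\<close>.\<close>

lemma dvd_poly_toda_mult_power2:
  assumes T: "C * B = poly_toda mu A" and B: "A dvd poly_toda mu B"
  shows "A dvd poly_toda mu C * B\<^sup>2"
proof -
  define X M where "X = [:0, 1 :: real:]" and "M = [:mu, 1:]"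
  have X': "pderiv X = 1" and M': "pderiv M = 1"
    by (simp_all add: X_def M_def pderiv_pCons)
  define a1 a2 a3 where "a1 = pderiv A" and "a2 = pderiv a1" and "a3 = pderiv a2"
  define F where "F = poly_toda mu A"
  define G where "G = M * A - X * a2 - a1"
  define K where "K = 2 * M * a1 - 2 * a2 - X * a3 + A"
  define K' where "K' = a1 + pderiv K"
  define f2 where "f2 = X * a2\<^sup>2 - a1 * a2 + 2 * M * a1\<^sup>2"
  \<comment> \<open>\<open>F\<close> and its two derivatives are written as a residue plus a
    multiple of \<open>A\<close>; the residues alone cancel in the corrected Toda
    expression.\<close>
  have F: "F = X * a1\<^sup>2 + A * G"
    unfolding F_def poly_toda_def G_def X_def[symmetric] M_def[symmetric] a1_def a2_def
    by algebra
  have F1: "pderiv F = X * a1 * a2 + A * K"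
    unfolding F G_def K_def
    by (simp add: pderiv_add pderiv_diff pderiv_mult X' M' power2_eq_square
        flip: a1_def a2_def a3_def) algebra
  have F2: "pderiv (pderiv F) = f2 + A * K'"
    unfolding F1 f2_def K'_def pderiv_add pderiv_mult X'
    unfolding K_def a1_def[symmetric] a2_def[symmetric] a3_def[symmetric] by algebra
  have "poly_toda mu F + M * F\<^sup>2 = A *
    (- X * (G * f2 + X * a1\<^sup>2 * K' + A * G * K' - 2 * X * a1 * a2 * K - A * K\<^sup>2)
     - (G * X * a1 * a2 + X * a1\<^sup>2 * K + A * G * K) + 2 * M * (2 * X * a1\<^sup>2 * G + A * G\<^sup>2))"
    unfolding poly_toda_def F2 X_def[symmetric] M_def[symmetric] unfolding F1 unfolding F f2_def
    by algebra
  then have "A dvd poly_toda mu F + M * F\<^sup>2"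
    by simp
  moreover have "poly_toda mu C * B\<^sup>2 = poly_toda mu (C * B) - C\<^sup>2 * poly_toda mu B
      + M * (C * B)\<^sup>2"
    unfolding poly_toda_def X_def[symmetric] M_def[symmetric] pderiv_mult pderiv_add by algebra
  then have "poly_toda mu C * B\<^sup>2 = (poly_toda mu F + M * F\<^sup>2) - C\<^sup>2 * poly_toda mu B"
    unfolding T F_def by simp
  ultimately show ?thesis
    using B by simp
qed

text \<open>The factor \<open>B\<^sup>2\<close> is removed by splitting \<open>A\<close> into a
  power of zeta and a part \<open>A0\<close> prime to zeta: \<open>A0\<close> is coprime to
  \<open>B\<close>, and the power of zeta is controlled by the order at zero.\<close>

lemma dvd_poly_toda:
  assumes nz: "A \<noteq> 0" "B \<noteq> 0" "C \<noteq> 0"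
    and T: "C * B = poly_toda mu A" and B: "A dvd poly_toda mu B"
    and AB: "\<And>p. prime_elem p \<Longrightarrow> \<not> p dvd [:0, 1:] \<Longrightarrow> \<not> (p dvd A \<and> p dvd B)"
    and ord: "order 0 B \<le> order 0 A"
  shows "A dvd poly_toda mu C" "order 0 A \<le> order 0 C"
proof -
  have "2 * order 0 A \<le> order 0 (poly_toda mu A)"
    using nz T by (intro order_0_poly_toda) auto
  also have "order 0 (poly_toda mu A) = order 0 C + order 0 B"
    using nz unfolding T[symmetric] by (intro order_mult) auto
  finally show le: "order 0 A \<le> order 0 C"
    using ord by simp
  define X where "X = [:0, 1 :: real:]"
  have X: "prime_elem X"
    unfolding X_def by (rule prime_elem_linear_field_poly) simp
  obtain A0 where A0: "A = X ^ order 0 A * A0" "\<not> X dvd A0"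
    using order_decomp[OF nz(1), of 0] unfolding X_def by auto
  have A0_nz: "A0 \<noteq> 0"
    using A0 by auto
  have prime: "\<not> p dvd X" if "prime_elem p" "p dvd A0" for p
  proof
    assume "p dvd X"
    then have "X dvd p"
      using X that(1) by (meson irreducibleD' prime_elem_imp_irreducible prime_elem_not_unit)
    with that(2) A0(2) show False
      by (meson dvd_trans)
  qed
  have coprime: "coprime A0 f" if f: "\<And>p. prime_elem p \<Longrightarrow> p dvd A0 \<Longrightarrow> \<not> p dvd f" for f
  proof (rule ccontr)
    assume "\<not> coprime A0 f"
    then obtain c where c: "c dvd A0" "c dvd f" "\<not> is_unit c"
      by (rule not_coprimeE)
    then obtain p where "prime p" "p dvd c"
      using prime_divisorE[of c] A0_nz by (metis dvd_0_left)
    then show False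
      using f[of p] c by (meson dvd_trans prime_imp_prime_elem)
  qed
  have "coprime A0 (B\<^sup>2)"
  proof (rule coprime)
    fix p assume p: "prime_elem p" "p dvd A0"
    then have "\<not> p dvd B"
      using AB[of p] prime[OF p] A0(1) unfolding X_def by (metis dvd_mult)
    with p show "\<not> p dvd B\<^sup>2"
      by (meson prime_elem_dvd_power)
  qed
  moreover have "A0 dvd poly_toda mu C * B\<^sup>2"
    using dvd_poly_toda_mult_power2[OF T B] A0(1) by (metis dvd_mult_right)
  ultimately have "A0 dvd poly_toda mu C"
    by (simp add: coprime_dvd_mult_left_iff)
  moreover have "X ^ order 0 A dvd poly_toda mu C"
  proof (cases "poly_toda mu C = 0")
    case False
    then have "order 0 A \<le> order 0 (poly_toda mu C)"
      using order_0_poly_toda[OF nz(3) False] le by simp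
    then have "[:- 0, 1:] ^ order 0 A dvd poly_toda mu C"
      unfolding order_divides by simp
    then show ?thesis
      by (simp add: X_def)
  qed simp
  moreover have "coprime (X ^ order 0 A) A0"
    using coprime[of "X ^ order 0 A"] prime by (meson coprime_commute prime_elem_dvd_power)
  ultimately show "A dvd poly_toda mu C"
    using divides_mult A0(1) by metis
qed

section \<open>Polynomials as Laurent series\<close>

interpretation fls: differential_field "fls_deriv :: real fls \<Rightarrow> real fls" fls_X
  by unfold_locales (simp_all add: add.commute)

text \<open>This embedding is injective and respects derivatives, so polynomial identities may be
  proved in the differential field and pulled back.\<close>

definition poly_fls :: "real poly \<Rightarrow> real fls" where
  "poly_fls p = fps_to_fls (fps_of_poly p)"

lemma poly_fls_eq_iff: "poly_fls p = poly_fls q \<longleftrightarrow> p = q"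
  by (simp add: poly_fls_def fps_of_poly_eq_iff)

lemma poly_fls_simps:
  "poly_fls 0 = 0" "poly_fls 1 = 1"
  "poly_fls [:c, 1:] = fls_X + fls_const c"
  "poly_fls (p + q) = poly_fls p + poly_fls q" "poly_fls (p - q) = poly_fls p - poly_fls q"
  "poly_fls (- p) = - poly_fls p" "poly_fls (p * q) = poly_fls p * poly_fls q"
  "poly_fls (p ^ n) = poly_fls p ^ n" "poly_fls (pderiv p) = fls_deriv (poly_fls p)"
  by (simp_all add: poly_fls_def fps_of_poly_add fps_of_poly_diff fps_of_poly_uminus
      fps_of_poly_mult fps_of_poly_power fps_of_poly_pderiv fps_of_poly_linear
      fls_times_fps_to_fls fps_to_fls_power fls_deriv_fps_to_fls)

lemma poly_fls_of_nat: "poly_fls (of_nat n) = of_nat n"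
  by (induction n) (simp_all add: poly_fls_simps)

lemma poly_fls_poly_toda: "poly_fls (poly_toda mu f) = fls.toda (fls_const mu) (poly_fls f)"
  by (simp only: poly_toda_def fls.toda_def poly_fls_simps fls_const_0 add_0_right)

section \<open>The polynomial recursion agrees with the recursion in the field\<close>

abbreviation tau :: "real \<Rightarrow> nat \<Rightarrow> real fls" where
  "tau mu \<equiv> fls.tau (fls_const mu)"

lemma tau_nonzero: "tau mu n \<noteq> 0"
  by (rule fls.tau_nonzero) simp

lemma tau_toda: "tau mu (Suc (Suc n)) * tau mu n = fls.toda (fls_const mu) (tau mu (Suc n))"
  using tau_nonzero by simp

lemma tau_wronskian:
  "fls_deriv (tau mu (Suc (Suc n))) * tau mu n - tau mu (Suc (Suc n)) * fls_deriv (tau mu n)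
    = of_nat (2 * n + 1) * (tau mu (Suc n))\<^sup>2"
proof -
  have "fls.L (tau mu (Suc (Suc n))) = fls.L (tau mu n)
      + of_nat (2 * n + 1) / fls.Q (fls_const mu) n"
    by (rule fls.L_gap) simp
  then show ?thesis
    using tau_nonzero[of mu n] tau_nonzero[of mu "Suc n"] tau_nonzero[of mu "Suc (Suc n)"]
    unfolding fls.L_def fls.Q_def by (simp add: field_simps del: fls.tau.simps)
qed

lemma Sshift_Suc_Suc: "Sshift mu (Suc (Suc n)) = poly_toda mu (Sshift mu (Suc n)) div Sshift mu n"
  by (simp add: poly_toda_def)

text \<open>\<open>div\<close> matches field division only where it is exact. The last three
  conjuncts are the invariants from which \<open>dvd_poly_toda\<close> derives exactness at the next
  index.\<close>

lemma poly_fls_Sshift_aux: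
  "poly_fls (Sshift mu n) = tau mu n \<and> poly_fls (Sshift mu (Suc n)) = tau mu (Suc n) \<and>
   poly_fls (Sshift mu (Suc (Suc n))) = tau mu (Suc (Suc n)) \<and>
   Sshift mu (Suc n) dvd poly_toda mu (Sshift mu n) \<and>
   order 0 (Sshift mu n) \<le> order 0 (Sshift mu (Suc n)) \<and>
   (\<forall>p. prime_elem p \<longrightarrow> \<not> p dvd [:0, 1:] \<longrightarrow> \<not> (p dvd Sshift mu n \<and> p dvd Sshift mu (Suc n)))"
proof (induction n)
  case 0
  have "poly_fls (Sshift mu (Suc (Suc 0))) = tau mu (Suc (Suc 0))"
    unfolding Sshift_Suc_Suc by (simp add: poly_fls_poly_toda poly_fls_simps)
  then show ?case
    by (auto simp: poly_fls_simps prime_elem_not_unit simp del: Sshift.simps(3) fls.tau.simps(3))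
next
  case (Suc n)
  define A B C where "A = Sshift mu (Suc n)" and "B = Sshift mu n" and "C = Sshift mu (Suc (Suc n))"
  have E: "poly_fls B = tau mu n" "poly_fls A = tau mu (Suc n)" "poly_fls C = tau mu (Suc (Suc n))"
    using Suc unfolding A_def B_def C_def by blast+
  have nz: "A \<noteq> 0" "B \<noteq> 0" "C \<noteq> 0"
    using E tau_nonzero poly_fls_simps(1) by metis+
  have T: "C * B = poly_toda mu A"
    unfolding poly_fls_eq_iff[symmetric] poly_fls_simps poly_fls_poly_toda E by (rule tau_toda)
  have W: "pderiv C * B - C * pderiv B = of_nat (2 * n + 1) * A\<^sup>2"
    unfolding poly_fls_eq_iff[symmetric] poly_fls_simps poly_fls_of_nat E by (rule tau_wronskian)
  have AB: "\<not> (p dvd A \<and> p dvd B)" if "prime_elem p" "\<not> p dvd [:0, 1:]" for p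
    using Suc that unfolding A_def B_def by blast
  have "A dvd poly_toda mu C" and ord: "order 0 A \<le> order 0 C"
    using dvd_poly_toda[OF nz T _ AB] Suc unfolding A_def B_def by blast+
  then have "Sshift mu (Suc (Suc (Suc n))) * A = poly_toda mu C"
    by (simp add: Sshift_Suc_Suc A_def C_def del: Sshift.simps(3))
  then have "poly_fls (Sshift mu (Suc (Suc (Suc n)))) * tau mu (Suc n)
      = fls.toda (fls_const mu) (tau mu (Suc (Suc n)))"
    using poly_fls_simps(7) poly_fls_poly_toda E by metis
  then have "poly_fls (Sshift mu (Suc (Suc (Suc n)))) = tau mu (Suc (Suc (Suc n)))"
    unfolding tau_toda[symmetric] using tau_nonzero[of mu "Suc n"]
    by (simp del: Sshift.simps(3) fls.tau.simps)
  moreover have "\<not> (p dvd A \<and> p dvd C)" if "prime_elem p" "\<not> p dvd [:0, 1:]" for p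
    using toda_no_common_prime[OF that nz(1,3) T W AB[OF that]] .
  moreover have "C dvd poly_toda mu A"
    unfolding T[symmetric] by simp
  ultimately show ?case
    using E ord unfolding A_def B_def C_def by blast
qed

lemma poly_fls_Sshift: "poly_fls (Sshift mu n) = tau mu n"
  using poly_fls_Sshift_aux by blast

lemma Sshift_nonzero: "Sshift mu n \<noteq> 0"
  using tau_nonzero[of mu n] poly_fls_simps(1) unfolding poly_fls_Sshift[symmetric] by metis

lemma Sshift_wronskian:
  "pderiv (Sshift mu (Suc (Suc n))) * Sshift mu n - Sshift mu (Suc (Suc n)) * pderiv (Sshift mu n)
    = of_nat (2 * n + 1) * (Sshift mu (Suc n))\<^sup>2"
  unfolding poly_fls_eq_iff[symmetric] poly_fls_simps poly_fls_of_nat poly_fls_Sshift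
  by (rule tau_wronskian)

text \<open>\<open>Y_relations\<close> with denominators cleared, so that the identities hold
  between polynomials and can be evaluated at real points.\<close>

lemma Sshift_shift_relations:
  fixes mu :: real
  defines "P \<equiv> Sshift mu" and "H \<equiv> Sshift (mu + 1)"
  shows "pderiv (P (Suc n)) * H n - P (Suc n) * pderiv (H n) + P (Suc n) * H n = H (Suc n) * P n"
    and "pderiv (H (Suc n)) * P n - H (Suc n) * pderiv (P n) - H (Suc n) * P n = - P (Suc n) * H n"
    and "[:0, 1:] * (pderiv (H (Suc n)) * P (Suc n) - H (Suc n) * pderiv (P (Suc n)))
      = [:mu - of_nat n, 1:] * P (Suc n) * H (Suc n) - P (Suc (Suc n)) * H n"
proof -
  define m where "m = fls_const mu"
  have m: "fls_deriv m = 0" and m1: "m + 1 = fls_const (mu + 1)"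
    by (simp_all add: m_def fls_plus_const[symmetric] del: fls_plus_const)
  note rel = fls.Y_relations[OF m, of n, unfolded fls.Y_def fls.Q_def fls.L_def m1]
  note nz = tau_nonzero[of mu, folded m_def] tau_nonzero[of "mu + 1"]
  note conv = poly_fls_eq_iff[symmetric] poly_fls_simps fls_const_0 add_0_right poly_fls_Sshift P_def H_def m_def[symmetric]
  show "pderiv (P (Suc n)) * H n - P (Suc n) * pderiv (H n) + P (Suc n) * H n = H (Suc n) * P n"
    unfolding conv using rel nz by (simp add: field_simps del: fls.tau.simps)
  show "pderiv (H (Suc n)) * P n - H (Suc n) * pderiv (P n) - H (Suc n) * P n = - P (Suc n) * H n"
    unfolding conv using rel nz by (simp add: field_simps del: fls.tau.simps)
  have c: "fls_const (mu - of_nat n) = m - of_nat n"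
    by (simp add: m_def fls_of_nat fls_minus_const)
  show "[:0, 1:] * (pderiv (H (Suc n)) * P (Suc n) - H (Suc n) * pderiv (P (Suc n)))
      = [:mu - of_nat n, 1:] * P (Suc n) * H (Suc n) - P (Suc (Suc n)) * H n"
    unfolding conv c using rel nz by (simp add: field_simps power2_eq_square del: fls.tau.simps)
qed

section \<open>From \<open>P\<^sub>I\<^sub>I\<^sub>I\<close> to \<open>P\<^sub>V\<close>\<close>

text \<open>Since \<^typ>\<open>real\<close> is a Euclidean ring here, these rules apply to division of reals and loop
  together with \<open>field_simps\<close>.\<close>

declare div_mult_self1 [simp del] div_mult_self2 [simp del]
  div_mult_self3 [simp del] div_mult_self4 [simp del]

section \<open>The first-order system at real points\<close>

lemma DERIV_poly_uminus:
  "((\<lambda>x::real. poly f (- x)) has_real_derivative - poly (pderiv f) (- x)) (at x)"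
proof -
  have "((\<lambda>x. poly f (- x)) has_real_derivative poly (pderiv f) (- x) * (- 1)) (at x)"
    by (rule DERIV_chain2[where f = "poly f" and g = "\<lambda>x. - x"])
      (auto intro!: derivative_eq_intros poly_DERIV)
  then show ?thesis
    by simp
qed

lemma DERIV_mult_log:
  fixes f g :: "real \<Rightarrow> real"
  assumes "(f has_real_derivative f x * a) (at x)" "(g has_real_derivative g x * b) (at x)"
  shows "((\<lambda>x. f x * g x) has_real_derivative (f x * g x) * (a + b)) (at x)"
  using DERIV_mult[OF assms] by (simp add: algebra_simps)

lemma DERIV_divide_log:
  fixes f g :: "real \<Rightarrow> real"
  assumes "(f has_real_derivative f x * a) (at x)" "(g has_real_derivative g x * b) (at x)"
    and "g x \<noteq> 0"
  shows "((\<lambda>x. f x / g x) has_real_derivative (f x / g x) * (a - b)) (at x)"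
proof -
  have "(f x * a * g x - f x * (g x * b)) / (g x * g x) = (f x / g x) * (a - b)"
    using assms(3) by (simp add: field_simps)
  then show ?thesis
    using DERIV_divide[OF assms] by (simp only:)
qed

text \<open>The polynomial relations are evaluated at zeta = -x. The equation for \<open>y\<close>
  says exactly that R = -2 q / x.\<close>

lemma painleve_three_system:
  fixes lam x :: real and n :: nat
  defines "p0 \<equiv> \<lambda>x. poly (Sshift lam n) (- x)"
    and "p1 \<equiv> \<lambda>x. poly (Sshift lam (Suc n)) (- x)"
    and "p2 \<equiv> \<lambda>x. poly (Sshift lam (Suc (Suc n))) (- x)"
    and "h0 \<equiv> \<lambda>x. poly (Sshift (lam + 1) n) (- x)"
    and "h1 \<equiv> \<lambda>x. poly (Sshift (lam + 1) (Suc n)) (- x)"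
  defines "y \<equiv> \<lambda>x. h1 x * p0 x / (p1 x * h0 x)"
    and "q \<equiv> \<lambda>x. p2 x * p0 x / (p1 x)\<^sup>2"
  assumes nz: "x \<noteq> 0" "p0 x \<noteq> 0" "p1 x \<noteq> 0" "p2 x \<noteq> 0" "h0 x \<noteq> 0" "h1 x \<noteq> 0"
  shows "(y has_real_derivative
      - (2 * q x + 2 * (real n - lam) * y x) / x - ((y x)\<^sup>2 + 1)) (at x)"
    and "(q has_real_derivative
      - (2 * real n + 1) - 2 * (real n - lam) * q x / x - 2 * q x * (q x + x) / (x * y x)) (at x)"
proof -
  define d0 d1 d2 e0 e1 where
    "d0 = poly (pderiv (Sshift lam n)) (- x)" and
    "d1 = poly (pderiv (Sshift lam (Suc n))) (- x)" and
    "d2 = poly (pderiv (Sshift lam (Suc (Suc n)))) (- x)" and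
    "e0 = poly (pderiv (Sshift (lam + 1) n)) (- x)" and
    "e1 = poly (pderiv (Sshift (lam + 1) (Suc n))) (- x)"
  note defs = p0_def p1_def p2_def h0_def h1_def d0_def d1_def d2_def e0_def e1_def
  have der: "(p0 has_real_derivative - d0) (at x)" "(p1 has_real_derivative - d1) (at x)"
     "(p2 has_real_derivative - d2) (at x)" "(h0 has_real_derivative - e0) (at x)"
     "(h1 has_real_derivative - e1) (at x)"
    unfolding defs by (rule DERIV_poly_uminus)+
  have W: "d2 * p0 x - p2 x * d0 = (2 * real n + 1) * (p1 x)\<^sup>2"
    using arg_cong[OF Sshift_wronskian[of lam n], of "\<lambda>f. poly f (- x)"]
    by (simp add: defs del: Sshift.simps)
  have B: "d1 * h0 x - p1 x * e0 + p1 x * h0 x = h1 x * p0 x"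
    "e1 * p0 x - h1 x * d0 - h1 x * p0 x = - p1 x * h0 x"
    "- x * (e1 * p1 x - h1 x * d1) = (lam - real n - x) * p1 x * h1 x - p2 x * h0 x"
    using arg_cong[OF Sshift_shift_relations(1)[of lam n], of "\<lambda>f. poly f (- x)"]
      arg_cong[OF Sshift_shift_relations(2)[of lam n], of "\<lambda>f. poly f (- x)"]
      arg_cong[OF Sshift_shift_relations(3)[of lam n], of "\<lambda>f. poly f (- x)"]
    unfolding defs by (simp_all add: left_diff_distrib del: Sshift.simps)
  have ynz: "y x \<noteq> 0"
    using nz by (simp add: y_def)
  \<comment> \<open>These are logarithmic derivatives in zeta; passing to x changes their
    sign.\<close>
  define a0 a1 a2 b0 b1 where "a0 = d0 / p0 x" and "a1 = d1 / p1 x" and "a2 = d2 / p2 x"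
    and "b0 = e0 / h0 x" and "b1 = e1 / h1 x"
  have L: "(a2 - a0) * q x = 2 * real n + 1"
  proof -
    have "(a2 - a0) * q x = (d2 * p0 x - p2 x * d0) / (p1 x)\<^sup>2"
      unfolding a2_def a0_def q_def using nz by (simp add: field_simps)
    then show ?thesis
      unfolding W using nz by simp
  qed
  have L1: "a1 - b0 = y x - 1"
  proof -
    have "a1 - b0 = (d1 * h0 x - p1 x * e0) / (p1 x * h0 x)"
      unfolding a1_def b0_def using nz by (simp add: field_simps)
    also have "d1 * h0 x - p1 x * e0 = h1 x * p0 x - p1 x * h0 x"
      using B(1) by linarith
    finally show ?thesis
      unfolding y_def using nz by (simp add: diff_divide_distrib)
  qed
  have L2: "b1 - a0 = 1 - 1 / y x"
  proof -
    have "b1 - a0 = (e1 * p0 x - h1 x * d0) / (h1 x * p0 x)"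
      unfolding b1_def a0_def using nz by (simp add: field_simps)
    also have "e1 * p0 x - h1 x * d0 = h1 x * p0 x - p1 x * h0 x"
      using B(2) by linarith
    finally show ?thesis
      unfolding y_def using nz by (simp add: diff_divide_distrib)
  qed
  have L3: "x * (b1 - a1) = x + (real n - lam) + q x / y x"
  proof -
    have "x * (b1 - a1) = x * (e1 * p1 x - h1 x * d1) / (p1 x * h1 x)"
      unfolding b1_def a1_def using nz by (simp add: field_simps)
    also have "x * (e1 * p1 x - h1 x * d1) = (x + (real n - lam)) * (p1 x * h1 x) + p2 x * h0 x"
      using B(3) by (simp add: algebra_simps)
    finally have "x * (b1 - a1) = x + (real n - lam) + p2 x * h0 x / (p1 x * h1 x)"
      using nz by (simp add: add_divide_distrib)
    moreover have "q x / y x = p2 x * h0 x / (p1 x * h1 x)"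
      unfolding q_def y_def using nz by (simp add: power2_eq_square)
    ultimately show ?thesis
      by simp
  qed
  have log_der: "(p0 has_real_derivative p0 x * - a0) (at x)"
     "(p1 has_real_derivative p1 x * - a1) (at x)" "(p2 has_real_derivative p2 x * - a2) (at x)"
     "(h0 has_real_derivative h0 x * - b0) (at x)" "(h1 has_real_derivative h1 x * - b1) (at x)"
    using der nz by (simp_all add: a0_def a1_def a2_def b0_def b1_def)
  have y': "(y has_real_derivative - (y x * (b1 + a0 - a1 - b0))) (at x)"
  proof -
    have "(y has_real_derivative y x * ((- b1 + - a0) - (- a1 + - b0))) (at x)"
      unfolding y_def using nz by (intro DERIV_divide_log DERIV_mult_log log_der) simp
    then show ?thesis
      by (simp add: algebra_simps)
  qed
  have q': "(q has_real_derivative - (q x * (a2 + a0 - 2 * a1))) (at x)"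
  proof -
    have "(q has_real_derivative q x * ((- a2 + - a0) - (- a1 + - a1))) (at x)"
      unfolding q_def power2_eq_square using nz
      by (intro DERIV_divide_log DERIV_mult_log log_der) simp
    then show ?thesis
      by (simp add: algebra_simps)
  qed
  have "x * (b1 + a0 - a1 - b0) = 2 * (x * (b1 - a1)) + x * (y x - 1) - x * (1 - 1 / y x)"
    unfolding L1[symmetric] L2[symmetric] by (simp add: algebra_simps)
  then have "x * (y x * (b1 + a0 - a1 - b0))
      = y x * (2 * (x * (b1 - a1)) + x * (y x - 1) - x * (1 - 1 / y x))"
    by (simp only: mult.left_commute[of x])
  also have "\<dots> = 2 * q x + 2 * (real n - lam) * y x + x * ((y x)\<^sup>2 + 1)"
    unfolding L3 using ynz by (simp add: field_simps power2_eq_square)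
  finally have "x * (y x * (b1 + a0 - a1 - b0))
      = 2 * q x + 2 * (real n - lam) * y x + x * ((y x)\<^sup>2 + 1)" .
  then have "- (y x * (b1 + a0 - a1 - b0))
      = - (2 * q x + 2 * (real n - lam) * y x) / x - ((y x)\<^sup>2 + 1)"
    using nz(1) by (simp add: field_simps)
  with y' show "(y has_real_derivative
      - (2 * q x + 2 * (real n - lam) * y x) / x - ((y x)\<^sup>2 + 1)) (at x)"
    by simp
  have "x * (a1 - a0) = x * (1 - 1 / y x) - x * (b1 - a1)"
    unfolding L2[symmetric] by (simp add: algebra_simps)
  also have "\<dots> = - (real n - lam) - (q x + x) / y x"
    unfolding L3 by (simp add: right_diff_distrib add_divide_distrib)
  finally have a: "x * (a1 - a0) = - (real n - lam) - (q x + x) / y x" .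
  have "x * (q x * (a2 + a0 - 2 * a1)) = x * ((a2 - a0) * q x) - 2 * q x * (x * (a1 - a0))"
    by (simp add: algebra_simps)
  then have "x * (q x * (a2 + a0 - 2 * a1))
      = (2 * real n + 1) * x + 2 * q x * ((real n - lam) + (q x + x) / y x)"
    unfolding L a by (simp add: algebra_simps)
  then have "q x * (a2 + a0 - 2 * a1)
      = ((2 * real n + 1) * x + 2 * q x * ((real n - lam) + (q x + x) / y x)) / x"
    using nz(1) by (simp add: nonzero_eq_divide_eq mult.commute)
  also have "\<dots> = 2 * real n + 1 + 2 * (real n - lam) * q x / x + 2 * q x * (q x + x) / (x * y x)"
    using nz(1) ynz by (simp add: field_simps)
  finally have "- (q x * (a2 + a0 - 2 * a1))
      = - (2 * real n + 1) - 2 * (real n - lam) * q x / x - 2 * q x * (q x + x) / (x * y x)"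
    by simp
  with q' show "(q has_real_derivative
      - (2 * real n + 1) - 2 * (real n - lam) * q x / x - 2 * q x * (q x + x) / (x * y x)) (at x)"
    by simp
qed

section \<open>The system for g and p and its consequences\<close>

lemma deriv_on_open:
  fixes f f' :: "real \<Rightarrow> real"
  assumes "open V" "s \<in> V" "\<And>s. s \<in> V \<Longrightarrow> deriv f s = f' s"
    and "(f' has_real_derivative c) (at s)"
  shows "deriv (deriv f) s = c"
proof -
  have "(deriv f has_real_derivative c) (at s)"
    using assms by (intro has_field_derivative_transform_within_open[OF assms(4) assms(1,2)]) simp
  then show ?thesis
    by (rule DERIV_imp_deriv)
qed

text \<open>The auxiliary function \<open>p\<close> makes the system first order;
  \<open>P\<^sub>V\<close> follows by eliminating it, and the equation for \<open>H\<close> from a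
  Hamiltonian form of the same system.\<close>

lemma painleve_five_system:
  fixes g p H :: "real \<Rightarrow> real" and \<alpha> lam s :: real
  assumes V: "open V" "s \<in> V" and pos: "\<And>s. s \<in> V \<Longrightarrow> 0 < s"
    and g01: "\<And>s. s \<in> V \<Longrightarrow> g s \<noteq> 0 \<and> g s \<noteq> 1"
    and g': "\<And>s. s \<in> V \<Longrightarrow> (g has_real_derivative
        (g s - 1) * (\<alpha> * g s - lam + g s * p s) / s) (at s)"
    and p': "\<And>s. s \<in> V \<Longrightarrow> (p has_real_derivative
        (s / (g s - 1) - (g s - 1) * (2 * \<alpha> * p s + (p s)\<^sup>2)) / (2 * s)) (at s)"
    and H: "\<And>s. s \<in> V \<Longrightarrow> H s = (s * deriv g s)^2 / (4 * g s * (g s - 1)^2)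
        - 1 / (4 * g s) * (lam + \<alpha> * g s)^2 + s * g s / (4 * (g s - 1))"
  shows "deriv (deriv g) s =
         (3 * g s - 1) / (2 * g s * (g s - 1)) * (deriv g s)^2 - deriv g s / s
         + (g s - 1)^2 / (2 * s^2) * (\<alpha>^2 * g s - lam^2 / g s) + g s / (2 * s)" (is ?PV)
    and "(s * deriv (deriv H) s)^2 =
         deriv H s * (4 * deriv H s - 1) * (H s - s * deriv H s)
         + 1/16 * (4 * (\<alpha> + lam) * deriv H s - lam)^2" (is ?SIG)
proof -
  define A where "A = (\<lambda>s. \<alpha> * g s - lam + g s * p s)"
  have dg: "deriv g s = (g s - 1) * A s / s" if "s \<in> V" for s
    unfolding A_def using g'[OF that] by (rule DERIV_imp_deriv)
  \<comment> \<open>\<open>K\<close> is \<open>H\<close> with the derivative of \<open>g\<close>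
    replaced by its value; the difference of squares in \<open>H\<close> then contains a factor
    \<open>g\<close> that cancels the denominator.\<close>
  define K where "K = (\<lambda>s. ((g s * p s - 2 * lam) * (2 * \<alpha> + p s) + s * g s / (g s - 1)) / 4)"
  have HK: "H s = K s" if "s \<in> V" for s
  proof -
    have nz: "g s \<noteq> 0" "g s - 1 \<noteq> 0" "s \<noteq> 0"
      using g01[OF that] pos[OF that] by auto
    have 1: "(s * deriv g s)^2 / (4 * g s * (g s - 1)^2) = (A s)^2 / (4 * g s)"
      unfolding dg[OF that] using nz by (simp add: power_mult_distrib power_divide)
    have "(A s)^2 - (lam + \<alpha> * g s)^2 = g s * ((g s * p s - 2 * lam) * (2 * \<alpha> + p s))"
      unfolding A_def by algebra
    then have 2: "(A s)^2 / (4 * g s) - 1 / (4 * g s) * (lam + \<alpha> * g s)^2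
        = (g s * p s - 2 * lam) * (2 * \<alpha> + p s) / 4"
      using nz by (simp add: field_simps)
    show ?thesis
      unfolding H[OF that] K_def 1 2 by (simp add: add_divide_distrib mult.commute)
  qed
  \<comment> \<open>The system reads g' = (2 (g - 1) / s) dK/dp and p' = -(2 (g - 1) / s) dK/dg with
    partial derivatives of \<open>K\<close>, so only the explicit dependence of \<open>K\<close> on
    s contributes.\<close>
  have dK: "(K has_real_derivative g s / (4 * (g s - 1))) (at s)" if "s \<in> V" for s
  proof -
    define u where "u = g s - 1"
    have u: "u \<noteq> 0" "g s = u + 1" and s: "s \<noteq> 0"
      using g01[OF that] pos[OF that] by (auto simp: u_def)
    define G P where "G = u * A s / s"
      and "P = (s / u - u * (2 * \<alpha> * p s + (p s)\<^sup>2)) / (2 * s)"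
    have G: "(g has_real_derivative G) (at s)" and P: "(p has_real_derivative P) (at s)"
      using g'[OF that] p'[OF that] by (simp_all add: G_def P_def u_def A_def)
    have sG: "s * G = u * A s" and sP: "2 * s * P = s / u - u * (2 * \<alpha> * p s + (p s)\<^sup>2)"
      using s by (simp_all add: G_def P_def)
    have "((\<lambda>s. (g s * p s - 2 * lam) * (2 * \<alpha> + p s) + s * g s / (g s - 1)) has_real_derivative
        (G * p s + g s * P) * (2 * \<alpha> + p s) + (g s * p s - 2 * lam) * P
        + ((g s + s * G) * u - s * g s * G) / u\<^sup>2) (at s)"
      using u(1)
      by (auto intro!: derivative_eq_intros G P simp: u_def power2_eq_square algebra_simps)
    then have "(K has_real_derivative ((G * p s + g s * P) * (2 * \<alpha> + p s)
        + (g s * p s - 2 * lam) * P + ((g s + s * G) * u - s * g s * G) / u\<^sup>2) / 4) (at s)"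
      unfolding K_def by (rule DERIV_cdivide)
    moreover have "((G * p s + g s * P) * (2 * \<alpha> + p s) + (g s * p s - 2 * lam) * P
        + ((g s + s * G) * u - s * g s * G) / u\<^sup>2) / 4 = g s / (4 * u)"
    proof -
      have "s * ((G * p s + g s * P) * (2 * \<alpha> + p s) + (g s * p s - 2 * lam) * P)
          = (s * G) * p s * (2 * \<alpha> + p s) + (2 * s * P) * A s"
        unfolding A_def by algebra
      also have "\<dots> = s * (A s / u)"
        unfolding sG sP by (simp add: algebra_simps power2_eq_square)
      finally have 1: "(G * p s + g s * P) * (2 * \<alpha> + p s) + (g s * p s - 2 * lam) * P = A s / u"
        using s unfolding mult_cancel_left by blast
      have "(g s + s * G) * u - s * g s * G = u * (g s - A s)"
        using sG u(2) by algebra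
      then have 2: "((g s + s * G) * u - s * g s * G) / u\<^sup>2 = g s / u - A s / u"
        using u(1) by (simp add: power2_eq_square diff_divide_distrib)
      show ?thesis
        unfolding 1 2 by simp
    qed
    ultimately show ?thesis
      unfolding u_def by (simp only:)
  qed
  have dH: "deriv H s = g s / (4 * (g s - 1))" if "s \<in> V" for s
    using has_field_derivative_transform_within_open[OF dK[OF that] V(1) that] HK
    by (intro DERIV_imp_deriv) metis
  have nz: "g s \<noteq> 0" "g s - 1 \<noteq> 0" "s \<noteq> 0"
    using g01[OF V(2)] pos[OF V(2)] by auto
  have ddH: "deriv (deriv H) s = - A s / (4 * s * (g s - 1))"
  proof (rule deriv_on_open[OF V dH])
    show "((\<lambda>s. g s / (4 * (g s - 1))) has_real_derivative - A s / (4 * s * (g s - 1))) (at s)"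
      using nz by (auto intro!: derivative_eq_intros g'[OF V(2)] simp: A_def divide_simps)
        (simp add: algebra_simps)
  qed
  define u where "u = g s - 1"
  have u: "u \<noteq> 0" "g s = u + 1" "u + 1 \<noteq> 0"
    using nz by (auto simp: u_def)
  define P where "P = (s / u - u * (2 * \<alpha> * p s + (p s)\<^sup>2)) / (2 * s)"
  have P: "(p has_real_derivative P) (at s)"
    using p'[OF V(2)] by (simp add: P_def u_def)
  have G: "(g has_real_derivative u * A s / s) (at s)"
    using g'[OF V(2)] by (simp add: u_def A_def)
  have ddg: "deriv (deriv g) s = (u * A s / s * A s + u * (u * A s / s * (\<alpha> + p s) + g s * P)) / s
      - u * A s / s\<^sup>2"
  proof (rule deriv_on_open[OF V dg])
    show "((\<lambda>s. (g s - 1) * A s / s) has_real_derivative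
      (u * A s / s * A s + u * (u * A s / s * (\<alpha> + p s) + g s * P)) / s - u * A s / s\<^sup>2) (at s)"
      using nz unfolding A_def
      by (auto intro!: derivative_eq_intros G[unfolded A_def] P
          simp: u_def divide_simps power2_eq_square) (simp add: algebra_simps)
  qed
  have sP: "2 * s * P = s / u - u * (2 * \<alpha> * p s + (p s)\<^sup>2)"
    using nz(3) by (simp add: P_def)
  \<comment> \<open>This is \<open>P\<^sub>V\<close> multiplied by 2 g s^2 after cancelling the
    common terms g s / 2 - u A of s^2 g''.\<close>
  have "2 * g s * u * (A s)\<^sup>2 + 2 * g s * u\<^sup>2 * A s * (\<alpha> + p s) - (g s)\<^sup>2 * u\<^sup>2 * (2 * \<alpha> * p s + (p s)\<^sup>2)
      = (3 * g s - 1) * u * (A s)\<^sup>2 + u\<^sup>2 * (\<alpha>\<^sup>2 * (g s)\<^sup>2 - lam\<^sup>2)"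
    unfolding A_def u_def by algebra
  moreover have "2 * g s * ((3 * g s - 1) * u * (A s)\<^sup>2 / (2 * g s)
      + u\<^sup>2 * (\<alpha>\<^sup>2 * g s - lam\<^sup>2 / g s) / 2)
      = (3 * g s - 1) * u * (A s)\<^sup>2 + u\<^sup>2 * (\<alpha>\<^sup>2 * (g s)\<^sup>2 - lam\<^sup>2)"
    using nz(1) by (simp add: field_simps power2_eq_square)
  moreover have "2 * g s * (u * (A s)\<^sup>2 + u\<^sup>2 * A s * (\<alpha> + p s)
      - g s * u\<^sup>2 * (2 * \<alpha> * p s + (p s)\<^sup>2) / 2)
      = 2 * g s * u * (A s)\<^sup>2 + 2 * g s * u\<^sup>2 * A s * (\<alpha> + p s)
        - (g s)\<^sup>2 * u\<^sup>2 * (2 * \<alpha> * p s + (p s)\<^sup>2)"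
    by (simp add: field_simps power2_eq_square)
  ultimately have "2 * g s * (u * (A s)\<^sup>2 + u\<^sup>2 * A s * (\<alpha> + p s)
      - g s * u\<^sup>2 * (2 * \<alpha> * p s + (p s)\<^sup>2) / 2)
      = 2 * g s * ((3 * g s - 1) * u * (A s)\<^sup>2 / (2 * g s)
      + u\<^sup>2 * (\<alpha>\<^sup>2 * g s - lam\<^sup>2 / g s) / 2)"
    by (simp only:)
  then have *: "u * (A s)\<^sup>2 + u\<^sup>2 * A s * (\<alpha> + p s) - g s * u\<^sup>2 * (2 * \<alpha> * p s + (p s)\<^sup>2) / 2
      = (3 * g s - 1) * u * (A s)\<^sup>2 / (2 * g s) + u\<^sup>2 * (\<alpha>\<^sup>2 * g s - lam\<^sup>2 / g s) / 2"
    using nz(1) unfolding mult_cancel_left by simp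
  have "s\<^sup>2 * deriv (deriv g) s
      = u * (A s)\<^sup>2 + u\<^sup>2 * A s * (\<alpha> + p s) + u * g s * (2 * s * P) / 2 - u * A s"
    unfolding ddg using nz(3) by (simp add: field_simps power2_eq_square)
  also have "\<dots> = (u * (A s)\<^sup>2 + u\<^sup>2 * A s * (\<alpha> + p s) - g s * u\<^sup>2 * (2 * \<alpha> * p s + (p s)\<^sup>2) / 2)
      + g s * s / 2 - u * A s"
    unfolding sP using u(1) by (simp add: field_simps power2_eq_square)
  also have "\<dots> = s\<^sup>2 * ((3 * g s - 1) / (2 * g s * u) * (u * A s / s)\<^sup>2 - u * A s / s / s
      + u\<^sup>2 / (2 * s\<^sup>2) * (\<alpha>\<^sup>2 * g s - lam\<^sup>2 / g s) + g s / (2 * s))"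
    unfolding * using nz(1,3) u(1) by (simp add: field_simps power2_eq_square)
  finally show ?PV
    unfolding dg[OF V(2)] u_def[symmetric] using nz(3) by simp
  have 1: "s * deriv (deriv H) s = - A s / (4 * u)"
    unfolding ddH u_def using nz by simp
  have 2: "4 * deriv H s - 1 = 1 / u" "deriv H s = g s / (4 * u)"
    unfolding dH[OF V(2)] using nz by (simp_all add: u_def field_simps)
  have 3: "H s - s * deriv H s = (g s * p s - 2 * lam) * (2 * \<alpha> + p s) / 4"
    unfolding 2 HK[OF V(2)] K_def u_def by (simp add: add_divide_distrib)
  have 4: "4 * (\<alpha> + lam) * deriv H s - lam = (\<alpha> * g s + lam) / u"
    unfolding 2 using u(1) by (simp add: u(2) field_simps)
  \<comment> \<open>The difference of squares behind \<open>K\<close> is also what remains of the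
    equation for \<open>H\<close> once every term is put over u^2.\<close>
  have "(A s)\<^sup>2 = g s * ((g s * p s - 2 * lam) * (2 * \<alpha> + p s)) + (\<alpha> * g s + lam)\<^sup>2"
    unfolding A_def by algebra
  then have 5: "(- A s / (4 * u))\<^sup>2 = (g s * ((g s * p s - 2 * lam) * (2 * \<alpha> + p s))
      + (\<alpha> * g s + lam)\<^sup>2) / (16 * u\<^sup>2)"
    by (simp add: power_divide power_mult_distrib)
  show ?SIG
    unfolding 1 2(1) 3 4 5 unfolding 2(2) using u(1) by (simp add: field_simps power2_eq_square)
qed

text \<open>The substitution s = x^2 contributes the factor 1 / (2 x). The derivatives enter only
  through the numerators q - x q' and q' y - q y'; in the second one \<open>lam\<close>
  cancels.\<close>

lemma painleve_five_system_of_three: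
  fixes q y :: "real \<Rightarrow> real" and k lam x :: real
  assumes x: "x > 0" "q x \<noteq> 0" "y x \<noteq> 0"
    and y': "(y has_real_derivative
      - (2 * q x + 2 * (k - lam) * y x) / x - ((y x)\<^sup>2 + 1)) (at x)"
    and q': "(q has_real_derivative
      - (2 * k + 1) - 2 * (k - lam) * q x / x - 2 * q x * (q x + x) / (x * y x)) (at x)"
  defines "\<alpha> \<equiv> k + 1/2" and "s \<equiv> x\<^sup>2" and "G \<equiv> 1 + x / q x" and "p \<equiv> q x / y x"
  shows "((\<lambda>s. 1 + sqrt s / q (sqrt s)) has_real_derivative
      (G - 1) * (\<alpha> * G - lam + G * p) / s) (at s)"
    and "((\<lambda>s. q (sqrt s) / y (sqrt s)) has_real_derivative
      (s / (G - 1) - (G - 1) * (2 * \<alpha> * p + p\<^sup>2)) / (2 * s)) (at s)"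
proof -
  have sx: "sqrt s = x" "s > 0"
    using x by (simp_all add: s_def)
  define dq dy where
    "dq = - (2 * k + 1) - 2 * (k - lam) * q x / x - 2 * q x * (q x + x) / (x * y x)" and
    "dy = - (2 * q x + 2 * (k - lam) * y x) / x - ((y x)\<^sup>2 + 1)"
  have root: "(sqrt has_real_derivative 1 / (2 * x)) (at s)"
    using DERIV_real_sqrt[OF sx(2)] sx by (simp add: field_simps)
  have q: "((\<lambda>s. q (sqrt s)) has_real_derivative dq * (1 / (2 * x))) (at s)"
    using DERIV_chain2[of q dq sqrt s "1 / (2 * x)" UNIV] q' root sx(1) by (simp add: dq_def)
  have y: "((\<lambda>s. y (sqrt s)) has_real_derivative dy * (1 / (2 * x))) (at s)"
    using DERIV_chain2[of y dy sqrt s "1 / (2 * x)" UNIV] y' root sx(1) by (simp add: dy_def)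
  have xdq: "q x - x * dq = (2 * k + 1) * (q x + x) - 2 * lam * q x + 2 * q x * (q x + x) / y x"
    unfolding dq_def using x by (simp add: field_simps)
  have dqy: "dq * y x - q x * dy = q x * (y x)\<^sup>2 - (2 * k + 1) * y x - q x"
    unfolding dq_def dy_def using x by (simp add: field_simps power2_eq_square)
  have "((\<lambda>s. sqrt s / q (sqrt s)) has_real_derivative
      (1 / (2 * x) * q (sqrt s) - sqrt s * (dq * (1 / (2 * x)))) / (q (sqrt s) * q (sqrt s))) (at s)"
    using x sx by (intro DERIV_divide root q) simp
  also have "(1 / (2 * x) * q (sqrt s) - sqrt s * (dq * (1 / (2 * x)))) / (q (sqrt s) * q (sqrt s))
      = (q x - x * dq) / (2 * x * (q x)\<^sup>2)"
    unfolding sx using x by (simp add: field_simps power2_eq_square)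
  also have "\<dots> = (G - 1) * (\<alpha> * G - lam + G * p) / s"
    unfolding xdq G_def \<alpha>_def p_def s_def using x by (simp add: field_simps power2_eq_square)
  finally show "((\<lambda>s. 1 + sqrt s / q (sqrt s)) has_real_derivative
      (G - 1) * (\<alpha> * G - lam + G * p) / s) (at s)"
    using DERIV_add[OF DERIV_const[of 1]] by fastforce
  have "((\<lambda>s. q (sqrt s) / y (sqrt s)) has_real_derivative
      (dq * (1 / (2 * x)) * y (sqrt s) - q (sqrt s) * (dy * (1 / (2 * x))))
        / (y (sqrt s) * y (sqrt s))) (at s)"
    using x sx by (intro DERIV_divide y q) simp
  also have "(dq * (1 / (2 * x)) * y (sqrt s) - q (sqrt s) * (dy * (1 / (2 * x))))
        / (y (sqrt s) * y (sqrt s)) = (dq * y x - q x * dy) / (2 * x * (y x)\<^sup>2)"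
    unfolding sx using x by (simp add: field_simps power2_eq_square)
  also have "\<dots> = (s / (G - 1) - (G - 1) * (2 * \<alpha> * p + p\<^sup>2)) / (2 * s)"
    unfolding dqy G_def \<alpha>_def p_def s_def using x by (simp add: field_simps power2_eq_square)
  finally show "((\<lambda>s. q (sqrt s) / y (sqrt s)) has_real_derivative
      (s / (G - 1) - (G - 1) * (2 * \<alpha> * p + p\<^sup>2)) / (2 * s)) (at s)" .
qed

section \<open>Exceptional points and the assembly of the theorem\<close>

lemma deriv_eq_0_on_open:
  fixes f :: "real \<Rightarrow> real"
  assumes "open V" "s \<in> V" "\<And>s. s \<in> V \<Longrightarrow> f s = 0"
  shows "deriv f s = 0"
  using has_field_derivative_transform_within_open[OF DERIV_const[of 0] assms(1,2), of f] assms(3)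
  by (intro DERIV_imp_deriv) simp

theorem theorem8:
  fixes k :: nat and lam \<alpha> :: real and y R g H :: "real \<Rightarrow> real"
  assumes alpha: "\<alpha> = real k + 1/2"
  assumes y_def: "y = (\<lambda>x. poly (S (lam + 1) (int k)) (-x) * poly (S lam (int k - 1)) (-x)
                       / (poly (S lam (int k)) (-x) * poly (S (lam + 1) (int k - 1)) (-x)))"
  assumes R_def: "R = (\<lambda>x. deriv y x + (y x)^2 + (2 * real k - 2 * lam) * y x / x + 1)"
  assumes g_def: "g = (\<lambda>s. 1 - 2 / R (sqrt s))"
  assumes H_def: "H = (\<lambda>s. (s * deriv g s)^2 / (4 * g s * (g s - 1)^2)
                        - 1 / (4 * g s) * (lam + (real k + 1/2) * g s)^2
                        + s * g s / (4 * (g s - 1)))"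
  shows "\<exists>F :: real set. finite F \<and>
    (\<exists>p q :: real poly. q \<noteq> 0 \<and>
       (\<forall>s>0. s \<notin> F \<longrightarrow> g s = poly p (sqrt s) / poly q (sqrt s))) \<and>
    (\<forall>s>0. s \<notin> F \<longrightarrow>
       deriv (deriv g) s =
         (3 * g s - 1) / (2 * g s * (g s - 1)) * (deriv g s)^2 - deriv g s / s
         + (g s - 1)^2 / (2 * s^2) * (\<alpha>^2 * g s - lam^2 / g s) + g s / (2 * s)) \<and>
    (\<forall>s>0. s \<notin> F \<longrightarrow>
       (s * deriv (deriv H) s)^2 =
         deriv H s * (4 * deriv H s - 1) * (H s - s * deriv H s)
         + 1/16 * (4 * (\<alpha> + lam) * deriv H s - lam)^2)"
proof -
  define P0 P1 P2 H0 H1 where "P0 = Sshift lam k" and "P1 = Sshift lam (Suc k)"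
    and "P2 = Sshift lam (Suc (Suc k))" and "H0 = Sshift (lam + 1) k"
    and "H1 = Sshift (lam + 1) (Suc k)"
  note poly_defs = P0_def P1_def P2_def H0_def H1_def
  have y_eq: "y = (\<lambda>x. poly H1 (- x) * poly P0 (- x) / (poly P1 (- x) * poly H0 (- x)))"
    unfolding y_def S_def poly_defs by (simp add: nat_add_distrib del: Sshift.simps)
  define q where "q = (\<lambda>x. poly P2 (- x) * poly P0 (- x) / (poly P1 (- x))\<^sup>2)"
  \<comment> \<open>\<open>N\<close> is the numerator of g = 1 + x / q over \<open>P2 * P0\<close>,
    with x = -zeta. It can vanish identically, as for k = 0 and \<open>lam\<close> = 0, hence the
    case distinction in \<open>W\<close>.\<close>
  define N where "N = P2 * P0 - [:0, 1:] * P1\<^sup>2"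
  define W where "W = [:0, 1:] * (P0 * P1 * P2 * H0 * H1 * (if N = 0 then 1 else N))"
  \<comment> \<open>Evaluation takes place at zeta = -sqrt s, so s is excluded when it is the square
    of a root of \<open>W\<close>; outside \<open>F\<close> all polynomials in use are nonzero
    there, except \<open>N\<close> when it is the zero polynomial.\<close>
  define F where "F = (\<lambda>t. t\<^sup>2) ` {t. poly W t = 0}"
  have nz: "P0 \<noteq> 0" "P1 \<noteq> 0" "P2 \<noteq> 0" "H0 \<noteq> 0" "H1 \<noteq> 0"
    unfolding poly_defs by (rule Sshift_nonzero)+
  then have "W \<noteq> 0"
    unfolding W_def by auto
  then have "finite F"
    unfolding F_def by (intro finite_imageI poly_roots_finite)
  define V where "V = {0<..} - F"
  have V: "open V"
    unfolding V_def using \<open>finite F\<close> by (intro open_Diff finite_imp_closed) auto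
  have pos: "0 < sqrt s" "0 < s" if "s \<in> V" for s
    using that by (auto simp: V_def)
  have W: "poly W (- sqrt s) \<noteq> 0" if "s \<in> V" for s
  proof
    assume "poly W (- sqrt s) = 0"
    then have "(- sqrt s)\<^sup>2 \<in> F"
      unfolding F_def by blast
    then show False
      using that pos(2)[OF that] by (simp add: V_def)
  qed
  have pnz: "poly P0 (- sqrt s) \<noteq> 0" "poly P1 (- sqrt s) \<noteq> 0" "poly P2 (- sqrt s) \<noteq> 0"
      "poly H0 (- sqrt s) \<noteq> 0" "poly H1 (- sqrt s) \<noteq> 0" if "s \<in> V" for s
    using W[OF that] by (auto simp: W_def)
  have qy: "q (sqrt s) \<noteq> 0" "y (sqrt s) \<noteq> 0" if "s \<in> V" for s
    using pnz[OF that] by (simp_all add: q_def y_eq)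
  have y': "(y has_real_derivative - (2 * q (sqrt s) + 2 * (real k - lam) * y (sqrt s)) / sqrt s
      - ((y (sqrt s))\<^sup>2 + 1)) (at (sqrt s))" if "s \<in> V" for s
    using pos[OF that] pnz[OF that] unfolding q_def y_eq poly_defs
    by (intro painleve_three_system(1)) (simp_all del: Sshift.simps)
  have q': "(q has_real_derivative - (2 * real k + 1) - 2 * (real k - lam) * q (sqrt s) / sqrt s
      - 2 * q (sqrt s) * (q (sqrt s) + sqrt s) / (sqrt s * y (sqrt s))) (at (sqrt s))"
    if "s \<in> V" for s
    using pos[OF that] pnz[OF that] unfolding q_def y_eq poly_defs
    by (intro painleve_three_system(2)) (simp_all del: Sshift.simps)
  have g_eq: "g s = 1 + sqrt s / q (sqrt s)" if "s \<in> V" for s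
  proof -
    have R: "R (sqrt s) = - 2 * q (sqrt s) / sqrt s"
      unfolding R_def DERIV_imp_deriv[OF y'[OF that]] using pos(1)[OF that]
      by (simp add: field_simps)
    show ?thesis
      unfolding g_def R using qy[OF that] pos(1)[OF that] by (simp add: field_simps)
  qed
  have g_rat: "g s = poly N (- sqrt s) / poly (P2 * P0) (- sqrt s)" if "s \<in> V" for s
    unfolding g_eq[OF that] q_def N_def using pnz[OF that]
    by (simp add: field_simps power2_eq_square)
  have "\<exists>p q :: real poly. q \<noteq> 0 \<and>
       (\<forall>s>0. s \<notin> F \<longrightarrow> g s = poly p (sqrt s) / poly q (sqrt s))"
  proof (intro exI conjI allI impI)
    show "(P2 * P0) \<circ>\<^sub>p [:0, - 1:] \<noteq> 0"
      using nz by (simp add: pcompose_eq_0_iff)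
    fix s assume "s > 0" "s \<notin> F"
    then show "g s = poly (N \<circ>\<^sub>p [:0, - 1:]) (sqrt s) / poly ((P2 * P0) \<circ>\<^sub>p [:0, - 1:]) (sqrt s)"
      using g_rat[of s] by (simp add: V_def poly_pcompose)
  qed
  moreover have "deriv (deriv g) s =
         (3 * g s - 1) / (2 * g s * (g s - 1)) * (deriv g s)^2 - deriv g s / s
         + (g s - 1)^2 / (2 * s^2) * (\<alpha>^2 * g s - lam^2 / g s) + g s / (2 * s) \<and>
       (s * deriv (deriv H) s)^2 =
         deriv H s * (4 * deriv H s - 1) * (H s - s * deriv H s)
         + 1/16 * (4 * (\<alpha> + lam) * deriv H s - lam)^2"
    if s: "s \<in> V" for s
  proof (cases "N = 0")
    case True
    have g0: "g s = 0" if "s \<in> V" for s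
      using g_rat[OF that] True by simp
    have dg0: "deriv g s = 0" if "s \<in> V" for s
      by (rule deriv_eq_0_on_open[OF V that g0])
    have ddg0: "deriv (deriv g) s = 0"
      by (rule deriv_eq_0_on_open[OF V s dg0])
    have H0: "H s = 0" if "s \<in> V" for s
      using g0[OF that] by (simp add: H_def)
    have dH0: "deriv H s = 0" if "s \<in> V" for s
      by (rule deriv_eq_0_on_open[OF V that H0])
    have ddH0: "deriv (deriv H) s = 0"
      by (rule deriv_eq_0_on_open[OF V s dH0])
    \<comment> \<open>Here \<open>q x = - x\<close> identically, and the differential equation of \<open>q\<close> leaves only \<open>lam = 0\<close>;
      division by \<open>g s = 0\<close> then makes both equations trivial.\<close>
    have q_eq: "q x = - x" if "poly P1 (- x) \<noteq> 0" for x
    proof -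
      have "poly (P2 * P0) (- x) = poly ([:0, 1:] * P1\<^sup>2) (- x)"
        using True by (simp add: N_def)
      then show ?thesis
        using that by (simp add: q_def field_simps)
    qed
    have "open {x. poly P1 (- x) \<noteq> 0}"
      by (intro open_Collect_neq continuous_intros)
    then have "(q has_real_derivative - 1) (at (sqrt s))"
      using pnz(2)[OF s] q_eq
      by (intro has_field_derivative_transform_within_open[of uminus "- 1" "sqrt s"
            "{x. poly P1 (- x) \<noteq> 0}" q]) (auto intro!: derivative_eq_intros)
    from DERIV_unique[OF this q'[OF s]] have "lam = 0"
      using q_eq[OF pnz(2)[OF s]] pos(1)[OF s] by simp
    then show ?thesis
      using g0[OF s] dg0[OF s] ddg0 H0[OF s] dH0[OF s] ddH0 by simp
  next
    case False
    define p where "p = (\<lambda>s. q (sqrt s) / y (sqrt s))"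
    have "poly N (- sqrt s) \<noteq> 0" if "s \<in> V" for s
      using W[OF that] False by (simp add: W_def)
    then have "g s \<noteq> 0" if "s \<in> V" for s
      using g_rat[OF that] pnz[OF that] that by simp
    moreover have "g s \<noteq> 1" if "s \<in> V" for s
      using g_eq[OF that] qy[OF that] pos[OF that] by simp
    ultimately have g01: "g s \<noteq> 0 \<and> g s \<noteq> 1" if "s \<in> V" for s
      using that by blast
    have g': "(g has_real_derivative (g s - 1) * (\<alpha> * g s - lam + g s * p s) / s) (at s)"
      if "s \<in> V" for s
    proof -
      have "((\<lambda>s. 1 + sqrt s / q (sqrt s)) has_real_derivative
          (g s - 1) * (\<alpha> * g s - lam + g s * p s) / s) (at s)"
        using painleve_five_system_of_three(1)[OF pos(1)[OF that] qy[OF that] y'[OF that] q'[OF that]]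
          pos(2)[OF that] unfolding g_eq[OF that] p_def alpha by simp
      then show ?thesis
        using V that by (rule has_field_derivative_transform_within_open) (simp add: g_eq)
    qed
    have p': "(p has_real_derivative
        (s / (g s - 1) - (g s - 1) * (2 * \<alpha> * p s + (p s)\<^sup>2)) / (2 * s)) (at s)"
      if "s \<in> V" for s
      using painleve_five_system_of_three(2)[OF pos(1)[OF that] qy[OF that] y'[OF that] q'[OF that]]
        pos(2)[OF that] unfolding g_eq[OF that] p_def alpha by simp
    show ?thesis
      using painleve_five_system[OF V s pos(2) g01 g' p', of H] unfolding H_def alpha by blast
  qed
  ultimately show ?thesis
    using \<open>finite F\<close> by (intro exI[of _ F]) (simp add: V_def)
qed

end
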